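(* Let $\epsilon\ge0$ and assume that with probability at least $1-\epsilon$ there is a permutation $\tau_n$ of $\mathcal X$ such that $$\forall M\in\mathcal M,\ \forall k\in\mathcal X,\qquad \big\|\hat f^{(M)}_k-f^{*,(M)}_{\tau_n(k)}\big\|_2\le\frac{\sigma(M)}2 .$$ Then with probability at least $1-\epsilon$ (with this same $\tau_n$), $$\forall k\in\mathcal X,\qquad \big\|\hat f_k-f^*_{\tau_n(k)}\big\|_2\le 4\inf_{M\in\mathcal M}\Big\{\big\|f^{*,(M)}_{\tau_n(k)}-f^*_{\tau_n(k)}\big\|_2+\sigma(M)\Big\}.$$
   Context: $\mathcal X$ is a finite set of size $K$. $(\mathcal Y,\mu)$ is a measured space with $\mu$ $\sigma$-finite, and $(f^*_k)_{k\in\mathcal X}$ are square integrable probability densities with respect to $\mu$ (the emission densities of a hidden Markov model). $(\mathfrak P_M)_{M\in\mathbb N}$ is a nested (nondecreasing) family of finite-dimensional subspaces of $\mathbf L^2(\mathcal Y,\mu)$ with dense union, and $f^{*,(M)}_k$ is the orthogonal projection of $f^*_k$ on $\mathfrak P_M$. $\mathcal M\subset\mathbb N$ is the set of model indices used. For each $M\in\mathcal M$, $(\hat f^{(M)}_k)_{k\in\mathcal X}\in(\mathfrak P_M)^K$ are given (random) estimators, with no assumption on how they are computed. $\sigma:\mathcal M\to\mathbb R_+$ is nondecreasing (it may also depend on $\epsilon$ and on the sample size $n$). State-by-state selection: for $k\in\mathcal X$ and $M\in\mathcal M$, with $M\wedge M'=\min(M,M')$, let $$A_k(M)=\sup_{M'\in\mathcal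 M}\Big\{\big\|\hat f^{(M')}_k-\hat f^{(M\wedge M')}_k\big\|_2-\sigma(M')\Big\},$$ $$\hat M_k\in\operatorname*{arg\,min}_{M\in\mathcal M}\{A_k(M)+2\sigma(M)\}\ \text{(a minimizer being assumed to exist)},\qquad \hat f_k=\hat f^{(\hat M_k)}_k .$$ *)

theory Defs
  imports "HOL-Probability.Probability"
begin

text \<open>
  Elements of the real Hilbert space L2 of a measure are represented by square integrable
  functions, and equality in L2 is equality almost everywhere. Accordingly, a linear subspace of
  L2 is a linear set of square integrable functions that is saturated under almost everywhere
  equality.
\<close>

definition L2_space :: "'y measure \<Rightarrow> ('y \<Rightarrow> real) set" where
  "L2_space \<mu> = {f \<in> borel_measurable \<mu>. integrable \<mu> (\<lambda>y. (f y)\<^sup>2)}"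

definition L2_inner :: "'y measure \<Rightarrow> ('y \<Rightarrow> real) \<Rightarrow> ('y \<Rightarrow> real) \<Rightarrow> real" where
  "L2_inner \<mu> f g = (\<integral>y. f y * g y \<partial>\<mu>)"

definition L2_norm :: "'y measure \<Rightarrow> ('y \<Rightarrow> real) \<Rightarrow> real" where
  "L2_norm \<mu> f = sqrt (L2_inner \<mu> f f)"

definition L2_subspace :: "'y measure \<Rightarrow> ('y \<Rightarrow> real) set \<Rightarrow> bool" where
  "L2_subspace \<mu> S \<longleftrightarrow>
     S \<subseteq> L2_space \<mu> \<and>
     (\<lambda>y. 0) \<in> S \<and>
     (\<forall>f\<in>S. \<forall>g\<in>S. (\<lambda>y. f y + g y) \<in> S) \<and>
     (\<forall>f\<in>S. \<forall>c. (\<lambda>y. c * f y) \<in> S) \<and>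
     (\<forall>f\<in>S. \<forall>g\<in>L2_space \<mu>. (AE y in \<mu>. f y = g y) \<longrightarrow> g \<in> S)"

text \<open>Finite-dimensionality is that of the space of almost everywhere classes: a finite set spans
  up to null sets.\<close>

definition L2_finite_dim :: "'y measure \<Rightarrow> ('y \<Rightarrow> real) set \<Rightarrow> bool" where
  "L2_finite_dim \<mu> S \<longleftrightarrow>
     (\<exists>B. finite B \<and> B \<subseteq> S \<and> (\<forall>f\<in>S. \<exists>c. AE y in \<mu>. f y = (\<Sum>b\<in>B. c b * b y)))"

definition L2_dense :: "'y measure \<Rightarrow> ('y \<Rightarrow> real) set \<Rightarrow> bool" where
  "L2_dense \<mu> D \<longleftrightarrow> (\<forall>f\<in>L2_space \<mu>. \<forall>\<delta>>0. \<exists>g\<in>D. L2_norm \<mu> (\<lambda>y. f y - g y) < \<delta>)"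

text \<open>A relation rather than a function, since the orthogonal projection \<open>g\<close> of \<open>f\<close> is determined
  only up to null sets.\<close>

definition is_L2_projection ::
    "'y measure \<Rightarrow> ('y \<Rightarrow> real) set \<Rightarrow> ('y \<Rightarrow> real) \<Rightarrow> ('y \<Rightarrow> real) \<Rightarrow> bool" where
  "is_L2_projection \<mu> S f g \<longleftrightarrow> g \<in> S \<and> (\<forall>h\<in>S. L2_inner \<mu> (\<lambda>y. f y - g y) h = 0)"

definition prob_density :: "'y measure \<Rightarrow> ('y \<Rightarrow> real) \<Rightarrow> bool" where
  "prob_density \<mu> f \<longleftrightarrow>
     f \<in> borel_measurable \<mu> \<and> (AE y in \<mu>. 0 \<le> f y) \<and> (\<integral>\<^sup>+y. ennreal (f y) \<partial>\<mu>) = 1"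

text \<open>``With probability at least \<open>p\<close>, \<open>Q\<close> holds'': \<open>Q\<close> holds on a measurable event of probability
  at least \<open>p\<close>. When the set of outcomes satisfying \<open>Q\<close> is measurable, this says that its
  probability is at least \<open>p\<close>; the present form remains meaningful when an arbitrary minimizer
  is selected for each outcome, which need not be measurable.\<close>

definition with_prob_ge :: "'w measure \<Rightarrow> real \<Rightarrow> ('w \<Rightarrow> bool) \<Rightarrow> bool" where
  "with_prob_ge P p Q \<longleftrightarrow> (\<exists>E\<in>sets P. measure P E \<ge> p \<and> (\<forall>\<omega>\<in>E. Q \<omega>))"

text \<open>The selection criterion is extended real valued: the supremum over an infinite set of model
  indices may be infinite.\<close>

definition model_bias ::
    "'y measure \<Rightarrow> nat set \<Rightarrow> (nat \<Rightarrow> real) \<Rightarrow> (nat \<Rightarrow> 'y \<Rightarrow> real) \<Rightarrow> nat \<Rightarrow> ereal" where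
  "model_bias \<mu> \<M> \<sigma> g M =
     (SUP M'\<in>\<M>. ereal (L2_norm \<mu> (\<lambda>y. g M' y - g (min M M') y) - \<sigma> M'))"

definition selects_model ::
    "'y measure \<Rightarrow> nat set \<Rightarrow> (nat \<Rightarrow> real) \<Rightarrow> (nat \<Rightarrow> 'y \<Rightarrow> real) \<Rightarrow> nat \<Rightarrow> bool" where
  "selects_model \<mu> \<M> \<sigma> g m \<longleftrightarrow>
     is_arg_min (\<lambda>M. model_bias \<mu> \<M> \<sigma> g M + ereal (2 * \<sigma> M)) (\<lambda>M. M \<in> \<M>) m"

end

theory Submission
  imports Defs
begin

text \<open>
  The statement is deterministic: on the event where every estimator lies within \<open>\<sigma> M / 2\<close> of the
  projection it estimates, the final bound holds for every outcome, so the same event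
  serves for hypothesis and conclusion. Fix a state, let \<open>f\<close> be its target density, \<open>p M\<close> the
  projection of \<open>f\<close> on the model \<open>M\<close>, \<open>g M\<close> the estimator, and \<open>b M\<close> the bias, that is the distance
  from \<open>p M\<close> to \<open>f\<close>.

  The criterion \<open>A M\<close> estimates the bias. It never exceeds \<open>b M\<close>: the deviations of \<open>g M\<close> and
  \<open>g M'\<close> from their projections are absorbed by the term \<open>\<sigma> M'\<close> subtracted in the criterion, and what
  remains is the distance between \<open>p M\<close> and \<open>p M'\<close>, which Pythagoras bounds by \<open>b M\<close> because the
  models are nested (\<open>model_bias_le_bias\<close>, \<open>L2_norm_projection_diff_le\<close>).

  To compare the selected index \<open>m\<close> with an arbitrary \<open>M\<close>, the path from \<open>g m\<close> to \<open>f\<close> is taken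
  through \<open>g M\<close>. The larger of \<open>m\<close> and \<open>M\<close> decides how the first leg is controlled. If \<open>m \<le> M\<close>, it
  is at most \<open>A m + \<sigma> M\<close>, and minimality of \<open>m\<close> gives \<open>A m \<le> A M + 2 * \<sigma> M\<close>. If \<open>M < m\<close>, it
  is at most \<open>A M + \<sigma> m\<close>, and minimality bounds \<open>\<sigma> m\<close>, since \<open>A m\<close> is never below \<open>- \<sigma> m\<close>.
  Both cases end below \<open>4 * (b M + \<sigma> M)\<close> (\<open>selected_estimator_le\<close>).
\<close>

section \<open>The seminorm on square integrable functions\<close>

lemma L2_space_mult_integrable:
  assumes "f \<in> L2_space \<mu>" and "g \<in> L2_space \<mu>"
  shows "integrable \<mu> (\<lambda>y. f y * g y)"
proof (rule Bochner_Integration.integrable_bound)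
  show "integrable \<mu> (\<lambda>y. (f y)\<^sup>2 + (g y)\<^sup>2)"
    using assms by (simp add: L2_space_def)
  show "(\<lambda>y. f y * g y) \<in> borel_measurable \<mu>"
    using assms by (auto simp: L2_space_def)
  have "\<bar>a * b\<bar> \<le> a\<^sup>2 + b\<^sup>2" for a b :: real
    using sum_squares_bound[of "\<bar>a\<bar>" "\<bar>b\<bar>"] mult_nonneg_nonneg[of "\<bar>a\<bar>" "\<bar>b\<bar>"]
    unfolding abs_mult power2_abs mult.assoc by linarith
  then show "AE y in \<mu>. norm (f y * g y) \<le> norm ((f y)\<^sup>2 + (g y)\<^sup>2)"
    by simp
qed

lemma L2_space_add:
  assumes "f \<in> L2_space \<mu>" and "g \<in> L2_space \<mu>"
  shows "(\<lambda>y. f y + g y) \<in> L2_space \<mu>"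
proof -
  have "integrable \<mu> (\<lambda>y. (f y)\<^sup>2 + (g y)\<^sup>2 + 2 * (f y * g y))"
    using assms L2_space_mult_integrable[OF assms] by (simp add: L2_space_def)
  then show ?thesis
    using assms by (auto simp: L2_space_def power2_sum mult.assoc)
qed

lemma L2_space_diff:
  assumes "f \<in> L2_space \<mu>" and "g \<in> L2_space \<mu>"
  shows "(\<lambda>y. f y - g y) \<in> L2_space \<mu>"
proof -
  have "(\<lambda>y. - g y) \<in> L2_space \<mu>"
    using assms(2) by (simp add: L2_space_def)
  from L2_space_add[OF assms(1) this] show ?thesis by simp
qed

lemma L2_norm_nonneg: "0 \<le> L2_norm \<mu> f"
  by (simp add: L2_norm_def L2_inner_def)

lemma L2_norm_zero [simp]: "L2_norm \<mu> (\<lambda>y. 0) = 0"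
  by (simp add: L2_norm_def L2_inner_def)

lemma L2_norm_power2: "(L2_norm \<mu> f)\<^sup>2 = (\<integral>y. (f y)\<^sup>2 \<partial>\<mu>)"
  by (simp add: L2_norm_def L2_inner_def power2_eq_square)

lemma L2_norm_diff_commute: "L2_norm \<mu> (\<lambda>y. f y - g y) = L2_norm \<mu> (\<lambda>y. g y - f y)"
proof -
  have "(f y - g y) * (f y - g y) = (g y - f y) * (g y - f y)" for y
    by (simp add: algebra_simps)
  then show ?thesis
    by (simp only: L2_norm_def L2_inner_def)
qed

text \<open>
  Minkowski's inequality comes from integrating the pointwise bound
  \<open>(f + g)\<^sup>2 \<le> (1 + t / s) * f\<^sup>2 + (1 + s / t) * g\<^sup>2\<close>, whose right-hand side becomes \<open>(s + t)\<^sup>2\<close> when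
  \<open>s\<close> and \<open>t\<close> bound the two norms. Taking \<open>s\<close> and \<open>t\<close> strictly above the norms covers functions of
  norm zero without a separate case.
\<close>

lemma L2_norm_add_le:
  assumes f: "f \<in> L2_space \<mu>" and g: "g \<in> L2_space \<mu>"
  shows "L2_norm \<mu> (\<lambda>y. f y + g y) \<le> L2_norm \<mu> f + L2_norm \<mu> g"
proof (rule field_le_epsilon)
  fix e :: real
  assume "0 < e"
  define s t where "s = L2_norm \<mu> f + e / 2" and "t = L2_norm \<mu> g + e / 2"
  have st: "0 < s" "0 < t" "L2_norm \<mu> f \<le> s" "L2_norm \<mu> g \<le> t"
    using \<open>0 < e\<close> L2_norm_nonneg[of \<mu> f] L2_norm_nonneg[of \<mu> g]
    by (simp_all add: s_def t_def)
  have pointwise: "(a + b)\<^sup>2 \<le> (1 + t / s) * a\<^sup>2 + (1 + s / t) * b\<^sup>2" for a b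
  proof -
    have "(1 + t / s) * a\<^sup>2 + (1 + s / t) * b\<^sup>2 - (a + b)\<^sup>2 = (t * a - s * b)\<^sup>2 / (s * t)"
      using st by (simp add: field_simps power2_eq_square)
    moreover have "0 \<le> (t * a - s * b)\<^sup>2 / (s * t)"
      using st by simp
    ultimately show ?thesis by linarith
  qed
  have int: "integrable \<mu> (\<lambda>y. (f y)\<^sup>2)" "integrable \<mu> (\<lambda>y. (g y)\<^sup>2)"
      "integrable \<mu> (\<lambda>y. (f y + g y)\<^sup>2)"
    using f g L2_space_add[OF f g] by (simp_all add: L2_space_def)
  have "(L2_norm \<mu> (\<lambda>y. f y + g y))\<^sup>2
      \<le> (\<integral>y. (1 + t / s) * (f y)\<^sup>2 + (1 + s / t) * (g y)\<^sup>2 \<partial>\<mu>)"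
    unfolding L2_norm_power2 using int by (intro integral_mono pointwise) simp_all
  also have "\<dots> = (1 + t / s) * (L2_norm \<mu> f)\<^sup>2 + (1 + s / t) * (L2_norm \<mu> g)\<^sup>2"
    unfolding L2_norm_power2 using int by simp
  also have "\<dots> \<le> (1 + t / s) * s\<^sup>2 + (1 + s / t) * t\<^sup>2"
    using st by (intro add_mono mult_left_mono power_mono L2_norm_nonneg) simp_all
  also have "\<dots> = (s + t)\<^sup>2"
    using st by (simp add: field_simps power2_eq_square)
  finally have "L2_norm \<mu> (\<lambda>y. f y + g y) \<le> s + t"
    by (rule power2_le_imp_le) (use st in simp)
  then show "L2_norm \<mu> (\<lambda>y. f y + g y) \<le> L2_norm \<mu> f + L2_norm \<mu> g + e"
    by (simp add: s_def t_def)
qed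

lemma L2_norm_triangle:
  assumes "f \<in> L2_space \<mu>" and "g \<in> L2_space \<mu>" and "h \<in> L2_space \<mu>"
  shows "L2_norm \<mu> (\<lambda>y. f y - h y)
    \<le> L2_norm \<mu> (\<lambda>y. f y - g y) + L2_norm \<mu> (\<lambda>y. g y - h y)"
  using L2_norm_add_le[OF L2_space_diff[OF assms(1,2)] L2_space_diff[OF assms(2,3)]] by simp

section \<open>Orthogonal projections\<close>

lemma L2_subspace_diff:
  assumes "L2_subspace \<mu> S" and "f \<in> S" and "g \<in> S"
  shows "(\<lambda>y. f y - g y) \<in> S"
proof -
  have add: "(\<lambda>y. u y + v y) \<in> S" if "u \<in> S" "v \<in> S" for u v
    using assms(1) that by (simp add: L2_subspace_def)
  have "(\<lambda>y. (-1) * g y) \<in> S"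
    using assms(1,3) unfolding L2_subspace_def by blast
  from add[OF assms(2) this] show ?thesis by simp
qed

text \<open>
  The vector \<open>q - p\<close> lies in \<open>T\<close>, hence is orthogonal to \<open>f - q\<close>; it is therefore a leg of the
  right triangle with hypotenuse \<open>p - f\<close>. In the application \<open>p\<close> is the projection of \<open>f\<close> on a subspace of \<open>T\<close>.
\<close>

lemma L2_norm_projection_diff_le:
  assumes T: "L2_subspace \<mu> T" and p: "p \<in> T"
    and q: "is_L2_projection \<mu> T f q" and f: "f \<in> L2_space \<mu>"
  shows "L2_norm \<mu> (\<lambda>y. q y - p y) \<le> L2_norm \<mu> (\<lambda>y. p y - f y)"
proof (rule power2_le_imp_le)
  have in_T: "q \<in> T" "p \<in> T"
    using p q by (auto simp: is_L2_projection_def)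
  then have in_L2: "q \<in> L2_space \<mu>" "p \<in> L2_space \<mu>"
    using T by (auto simp: L2_subspace_def)
  define u v where "u = (\<lambda>y. f y - q y)" and "v = (\<lambda>y. q y - p y)"
  have uv: "u \<in> L2_space \<mu>" "v \<in> L2_space \<mu>"
    unfolding u_def v_def using in_L2 f by (simp_all add: L2_space_diff)
  have orth: "(\<integral>y. u y * v y \<partial>\<mu>) = 0"
    using q L2_subspace_diff[OF T in_T]
    by (simp add: is_L2_projection_def L2_inner_def u_def v_def)
  have int: "integrable \<mu> (\<lambda>y. (u y)\<^sup>2)" "integrable \<mu> (\<lambda>y. (v y)\<^sup>2)"
      "integrable \<mu> (\<lambda>y. u y * v y)"
    using uv L2_space_mult_integrable[OF uv] by (simp_all add: L2_space_def)
  have "(L2_norm \<mu> (\<lambda>y. p y - f y))\<^sup>2 = (\<integral>y. (u y)\<^sup>2 + (v y)\<^sup>2 + 2 * (u y * v y) \<partial>\<mu>)"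
    unfolding L2_norm_power2 u_def v_def
    by (intro Bochner_Integration.integral_cong) (simp_all add: power2_eq_square algebra_simps)
  also have "\<dots> = (\<integral>y. (u y)\<^sup>2 \<partial>\<mu>) + (\<integral>y. (v y)\<^sup>2 \<partial>\<mu>)"
    using int orth by simp
  finally show "(L2_norm \<mu> (\<lambda>y. q y - p y))\<^sup>2 \<le> (L2_norm \<mu> (\<lambda>y. p y - f y))\<^sup>2"
    unfolding L2_norm_power2[of \<mu> "\<lambda>y. q y - p y"] by (simp add: v_def)
qed (rule L2_norm_nonneg)

section \<open>The selection criterion\<close>

lemma model_bias_ge:
  assumes "M' \<in> \<M>"
  shows "ereal (L2_norm \<mu> (\<lambda>y. g M' y - g (min M M') y) - \<sigma> M') \<le> model_bias \<mu> \<M> \<sigma> g M"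
  unfolding model_bias_def by (rule SUP_upper2[OF assms]) (rule order_refl)

text \<open>
  Only indices \<open>M'\<close> above \<open>M\<close> contribute a distance to the criterion. There the two estimation
  errors add up to at most \<open>\<sigma> M / 2 + \<sigma> M' / 2 \<le> \<sigma> M'\<close>, which is where monotonicity of the
  penalty is used and why the factor one half appears in the error bound.
\<close>

lemma model_bias_le_bias:
  assumes "M \<in> \<M>"
    and g: "\<And>N. N \<in> \<M> \<Longrightarrow> g N \<in> L2_space \<mu>"
    and p: "\<And>N. N \<in> \<M> \<Longrightarrow> p N \<in> L2_space \<mu>"
    and \<sigma>: "\<And>N. N \<in> \<M> \<Longrightarrow> 0 \<le> \<sigma> N" "mono_on \<M> \<sigma>"
    and err: "\<And>N. N \<in> \<M> \<Longrightarrow> L2_norm \<mu> (\<lambda>y. g N y - p N y) \<le> \<sigma> N / 2"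
    and proj: "\<And>N. N \<in> \<M> \<Longrightarrow> M \<le> N \<Longrightarrow>
      L2_norm \<mu> (\<lambda>y. p N y - p M y) \<le> L2_norm \<mu> (\<lambda>y. p M y - f y)"
  shows "model_bias \<mu> \<M> \<sigma> g M \<le> ereal (L2_norm \<mu> (\<lambda>y. p M y - f y))"
  unfolding model_bias_def
proof (rule SUP_least)
  fix N
  assume N: "N \<in> \<M>"
  have "L2_norm \<mu> (\<lambda>y. g N y - g (min M N) y) - \<sigma> N \<le> L2_norm \<mu> (\<lambda>y. p M y - f y)"
  proof (cases "M \<le> N")
    case True
    have "L2_norm \<mu> (\<lambda>y. g N y - g M y)
        \<le> L2_norm \<mu> (\<lambda>y. g N y - p N y) + L2_norm \<mu> (\<lambda>y. p N y - g M y)"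
      by (intro L2_norm_triangle g p N \<open>M \<in> \<M>\<close>)
    moreover have "L2_norm \<mu> (\<lambda>y. p N y - g M y)
        \<le> L2_norm \<mu> (\<lambda>y. p N y - p M y) + L2_norm \<mu> (\<lambda>y. p M y - g M y)"
      by (intro L2_norm_triangle g p N \<open>M \<in> \<M>\<close>)
    ultimately have "L2_norm \<mu> (\<lambda>y. g N y - g M y)
        \<le> \<sigma> N / 2 + L2_norm \<mu> (\<lambda>y. p M y - f y) + \<sigma> M / 2"
      using err[OF N] err[OF \<open>M \<in> \<M>\<close>] proj[OF N True]
        L2_norm_diff_commute[of \<mu> "p M" "g M"] by linarith
    moreover have "\<sigma> M \<le> \<sigma> N"
      using \<sigma>(2) \<open>M \<in> \<M>\<close> N True by (rule mono_onD)
    ultimately show ?thesis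
      using True by (simp add: min_absorb1)
  next
    case False
    then show ?thesis
      using \<sigma>(1)[OF N] L2_norm_nonneg[of \<mu> "\<lambda>y. p M y - f y"]
      by (simp add: min_absorb2)
  qed
  then show "ereal (L2_norm \<mu> (\<lambda>y. g N y - g (min M N) y) - \<sigma> N)
      \<le> ereal (L2_norm \<mu> (\<lambda>y. p M y - f y))"
    by simp
qed

text \<open>
  The criterion \<open>A = model_bias \<mu> \<M> \<sigma> g\<close> enters through two facts: each of its terms is a lower
  bound of it, and \<open>A M\<close> is at most the bias of \<open>M\<close>. Combined with minimality of \<open>m\<close>
  they say that every term of \<open>A m\<close>, increased by \<open>2 * \<sigma> m\<close>, stays below the bias of \<open>M\<close> plus
  \<open>2 * \<sigma> M\<close>.
\<close>

lemma selected_estimator_le: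
  assumes sel: "selects_model \<mu> \<M> \<sigma> g m" and M: "M \<in> \<M>"
    and f: "f \<in> L2_space \<mu>"
    and g: "\<And>N. N \<in> \<M> \<Longrightarrow> g N \<in> L2_space \<mu>"
    and p: "\<And>N. N \<in> \<M> \<Longrightarrow> p N \<in> L2_space \<mu>"
    and \<sigma>: "\<And>N. N \<in> \<M> \<Longrightarrow> 0 \<le> \<sigma> N" "mono_on \<M> \<sigma>"
    and err: "\<And>N. N \<in> \<M> \<Longrightarrow> L2_norm \<mu> (\<lambda>y. g N y - p N y) \<le> \<sigma> N / 2"
    and proj: "\<And>N. N \<in> \<M> \<Longrightarrow> M \<le> N \<Longrightarrow>
      L2_norm \<mu> (\<lambda>y. p N y - p M y) \<le> L2_norm \<mu> (\<lambda>y. p M y - f y)"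
  shows "L2_norm \<mu> (\<lambda>y. g m y - f y) \<le> 4 * (L2_norm \<mu> (\<lambda>y. p M y - f y) + \<sigma> M)"
proof -
  let ?A = "model_bias \<mu> \<M> \<sigma> g"
  define b where "b = L2_norm \<mu> (\<lambda>y. p M y - f y)"
  have m: "m \<in> \<M>"
    using sel by (simp add: selects_model_def is_arg_min_def)
  have minimal: "?A m + ereal (2 * \<sigma> m) \<le> ?A M + ereal (2 * \<sigma> M)"
    using sel M by (auto simp: selects_model_def is_arg_min_def not_less)
  have A_le: "?A M \<le> ereal b"
    unfolding b_def
    by (rule model_bias_le_bias[where p = p and f = f]; (rule M g p \<sigma> err proj)?; assumption?)
  have term_m: "L2_norm \<mu> (\<lambda>y. g N y - g (min m N) y) - \<sigma> N + 2 * \<sigma> m \<le> b + 2 * \<sigma> M"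
    if "N \<in> \<M>" for N
  proof -
    have "ereal (L2_norm \<mu> (\<lambda>y. g N y - g (min m N) y) - \<sigma> N) + ereal (2 * \<sigma> m)
        \<le> ?A m + ereal (2 * \<sigma> m)"
      by (intro add_right_mono model_bias_ge that)
    also have "\<dots> \<le> ?A M + ereal (2 * \<sigma> M)"
      by (rule minimal)
    also have "\<dots> \<le> ereal b + ereal (2 * \<sigma> M)"
      by (intro add_right_mono A_le)
    finally show ?thesis by simp
  qed
  have term_M: "L2_norm \<mu> (\<lambda>y. g m y - g (min M m) y) - \<sigma> m \<le> b"
    using order_trans[OF model_bias_ge[OF m] A_le] by simp
  have step: "L2_norm \<mu> (\<lambda>y. g m y - g M y) \<le> 3 * b + 3 * \<sigma> M"
  proof (cases "m \<le> M")
    case True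
    then show ?thesis
      using term_m[OF M] \<sigma>(1)[OF m] L2_norm_nonneg[of \<mu> "\<lambda>y. p M y - f y"]
        L2_norm_diff_commute[of \<mu> "g M" "g m"]
      by (simp add: min_absorb1 b_def)
  next
    case False
    (* the term of index m vanishes in the criterion at m, up to its penalty *)
    have "\<sigma> m \<le> b + 2 * \<sigma> M"
      using term_m[OF m] by simp
    then show ?thesis
      using False term_M \<sigma>(1)[OF M] L2_norm_nonneg[of \<mu> "\<lambda>y. p M y - f y"]
      by (simp add: min_absorb1 b_def)
  qed
  have "L2_norm \<mu> (\<lambda>y. g m y - f y)
      \<le> L2_norm \<mu> (\<lambda>y. g m y - g M y) + L2_norm \<mu> (\<lambda>y. g M y - f y)"
    by (intro L2_norm_triangle g f m M)
  moreover have "L2_norm \<mu> (\<lambda>y. g M y - f y) \<le> L2_norm \<mu> (\<lambda>y. g M y - p M y) + b"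
    unfolding b_def by (intro L2_norm_triangle g p f M)
  ultimately show ?thesis
    using step err[OF M] \<sigma>(1)[OF M] unfolding b_def[symmetric] by argo
qed

section \<open>The inequality with high probability\<close>

theorem theorem2:
  fixes P :: "'w measure"
    and \<mu> :: "'y measure"
    and fstar :: "'x::finite \<Rightarrow> 'y \<Rightarrow> real"
    and \<PP> :: "nat \<Rightarrow> ('y \<Rightarrow> real) set"
    and fproj :: "nat \<Rightarrow> 'x \<Rightarrow> 'y \<Rightarrow> real"
    and \<M> :: "nat set"
    and fhat :: "'w \<Rightarrow> nat \<Rightarrow> 'x \<Rightarrow> 'y \<Rightarrow> real"
    and \<sigma> :: "nat \<Rightarrow> real"
    and Mhat :: "'w \<Rightarrow> 'x \<Rightarrow> nat"
    and \<tau> :: "'w \<Rightarrow> 'x \<Rightarrow> 'x"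
    and \<epsilon> :: real
  assumes "prob_space P"
    and "sigma_finite_measure \<mu>"
    and "\<And>k. prob_density \<mu> (fstar k)"
    and "\<And>k. fstar k \<in> L2_space \<mu>"
    and "\<And>M. L2_subspace \<mu> (\<PP> M)"
    and "\<And>M. L2_finite_dim \<mu> (\<PP> M)"
    and "mono \<PP>"
    and "L2_dense \<mu> (\<Union>M. \<PP> M)"
    and "\<And>M k. is_L2_projection \<mu> (\<PP> M) (fstar k) (fproj M k)"
    and "\<And>\<omega> M k. \<omega> \<in> space P \<Longrightarrow> M \<in> \<M> \<Longrightarrow> fhat \<omega> M k \<in> \<PP> M"
    and "\<And>M. M \<in> \<M> \<Longrightarrow> 0 \<le> \<sigma> M"
    and "mono_on \<M> \<sigma>"
    and "\<And>\<omega> k. \<omega> \<in> space P \<Longrightarrow> selects_model \<mu> \<M> \<sigma> (\<lambda>M. fhat \<omega> M k) (Mhat \<omega> k)"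
    and "0 \<le> \<epsilon>"
    and "with_prob_ge P (1 - \<epsilon>) (\<lambda>\<omega>. bij (\<tau> \<omega>) \<and>
           (\<forall>M\<in>\<M>. \<forall>k. L2_norm \<mu> (\<lambda>y. fhat \<omega> M k y - fproj M (\<tau> \<omega> k) y) \<le> \<sigma> M / 2))"
  shows "with_prob_ge P (1 - \<epsilon>) (\<lambda>\<omega>. bij (\<tau> \<omega>) \<and>
           (\<forall>M\<in>\<M>. \<forall>k. L2_norm \<mu> (\<lambda>y. fhat \<omega> M k y - fproj M (\<tau> \<omega> k) y) \<le> \<sigma> M / 2) \<and>
           (\<forall>k. L2_norm \<mu> (\<lambda>y. fhat \<omega> (Mhat \<omega> k) k y - fstar (\<tau> \<omega> k) y)
                \<le> 4 * (INF M\<in>\<M>. L2_norm \<mu> (\<lambda>y. fproj M (\<tau> \<omega> k) y - fstar (\<tau> \<omega> k) y) + \<sigma> M)))"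
proof -
  obtain E where E: "E \<in> sets P" "1 - \<epsilon> \<le> measure P E"
    and good: "\<And>\<omega>. \<omega> \<in> E \<Longrightarrow> bij (\<tau> \<omega>)"
      "\<And>\<omega> M k. \<omega> \<in> E \<Longrightarrow> M \<in> \<M> \<Longrightarrow>
        L2_norm \<mu> (\<lambda>y. fhat \<omega> M k y - fproj M (\<tau> \<omega> k) y) \<le> \<sigma> M / 2"
    using assms(15) unfolding with_prob_ge_def by blast
  have model_L2: "\<PP> M \<subseteq> L2_space \<mu>" for M
    using assms(5) by (simp add: L2_subspace_def)
  have fproj_in: "fproj M k \<in> \<PP> M" for M k
    using assms(9) by (simp add: is_L2_projection_def)
  have risk_bound: "L2_norm \<mu> (\<lambda>y. fhat \<omega> (Mhat \<omega> k) k y - fstar (\<tau> \<omega> k) y)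
      \<le> 4 * (INF M\<in>\<M>. L2_norm \<mu> (\<lambda>y. fproj M (\<tau> \<omega> k) y - fstar (\<tau> \<omega> k) y) + \<sigma> M)"
    (is "?r \<le> 4 * (INF M\<in>\<M>. ?c M)") if \<omega>: "\<omega> \<in> E" for \<omega> k
  proof -
    have space: "\<omega> \<in> space P"
      using sets.sets_into_space[OF E(1)] \<omega> by blast
    note sel = assms(13)[OF space, of k]
    have "?r \<le> 4 * ?c M" if "M \<in> \<M>" for M
    proof (rule selected_estimator_le[OF sel that, where p = "\<lambda>N. fproj N (\<tau> \<omega> k)"])
      show "fhat \<omega> N k \<in> L2_space \<mu>" if "N \<in> \<M>" for N
        using assms(10)[OF space that] model_L2 by blast
      show "fproj N (\<tau> \<omega> k) \<in> L2_space \<mu>" for N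
        using fproj_in model_L2 by blast
      show "L2_norm \<mu> (\<lambda>y. fproj N (\<tau> \<omega> k) y - fproj M (\<tau> \<omega> k) y)
          \<le> L2_norm \<mu> (\<lambda>y. fproj M (\<tau> \<omega> k) y - fstar (\<tau> \<omega> k) y)" if "M \<le> N" for N
        using assms(5) subsetD[OF monoD[OF assms(7) that] fproj_in] assms(9,4)
        by (rule L2_norm_projection_diff_le)
    qed (use assms(4,11,12) good(2)[OF \<omega>] in auto)
    then have "\<And>M. M \<in> \<M> \<Longrightarrow> ?r / 4 \<le> ?c M"
      by (simp add: field_simps)
    moreover have "\<M> \<noteq> {}"
      using sel by (auto simp: selects_model_def is_arg_min_def)
    ultimately have "?r / 4 \<le> (INF M\<in>\<M>. ?c M)"
      by (intro cINF_greatest)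
    then show ?thesis by simp
  qed
  show ?thesis
    unfolding with_prob_ge_def using E good risk_bound by blast
qed

end
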